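(* Let $K\ge 2$ be an integer, let $f$ be a calibrator, and let $\mathbf P=(P_1,\dots,P_K)$ be an exchangeable random vector each of whose components is uniformly distributed on $[0,1]$. Then for each $\alpha\in(0,1)$, $$\mathbb P\left(\exists\, k\le K:\ \frac1k\sum_{i=1}^k f\left(\frac{P_i}{\alpha}\right)\ge 1\right)\le \alpha .$$
   Context: A calibrator is a decreasing (i.e. non-increasing) function $f:[0,\infty)\to[0,\infty]$ with $f=0$ on $(1,\infty)$ and $\int_0^1 f(p)\,\mathrm dp\le 1$. A random vector $(P_1,\dots,P_K)$ is exchangeable if $(P_1,\dots,P_K)$ and $(P_{\sigma(1)},\dots,P_{\sigma(K)})$ have the same distribution for every permutation $\sigma$ of $\{1,\dots,K\}$. *)

theory Defs
  imports "HOL-Probability.Probability" "HOL-Combinatorics.Permutations"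
begin

text \<open>
  A function with domain \<open>[0,\<infinity>)\<close> is encoded as an element of \<open>extensional {0..}\<close>. The fixed value
  taken at negative arguments is irrelevant, but it makes a calibrator Borel measurable as a total
  function on the reals (see below), so that events defined through it are measurable.
\<close>

definition calibrator :: "(real \<Rightarrow> ennreal) \<Rightarrow> bool" where
  "calibrator f \<longleftrightarrow>
     f \<in> extensional {0..} \<and>
     antimono_on {0..} f \<and>
     (\<forall>p>1. f p = 0) \<and>
     (\<integral>\<^sup>+p\<in>{0..1}. f p \<partial>lborel) \<le> 1"

text \<open>The random vector \<open>(P\<^sub>i)\<^sub>i\<close> is indexed by \<open>i \<in> I\<close>.\<close>

definition exchangeable :: "'a measure \<Rightarrow> 'i set \<Rightarrow> ('i \<Rightarrow> 'a \<Rightarrow> real) \<Rightarrow> bool" where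
  "exchangeable M I P \<longleftrightarrow>
     (\<forall>i\<in>I. P i \<in> borel_measurable M) \<and>
     (\<forall>\<sigma>. \<sigma> permutes I \<longrightarrow>
        distr M (\<Pi>\<^sub>M i\<in>I. borel) (\<lambda>\<omega>. \<lambda>i\<in>I. P (\<sigma> i) \<omega>) =
        distr M (\<Pi>\<^sub>M i\<in>I. borel) (\<lambda>\<omega>. \<lambda>i\<in>I. P i \<omega>))"

lemma calibrator_borel_measurable:
  assumes "calibrator f"
  shows "f \<in> borel_measurable borel"
proof (rule borel_measurableI_greater)
  fix y
  have anti: "f b \<le> f a" if "0 \<le> a" "a \<le> b" for a b
    using assms that by (auto simp: calibrator_def monotone_on_def)
  have undef: "f a = undefined" if "a < 0" for a
    using assms that by (auto simp: calibrator_def extensional_def)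
  have "is_interval {x. 0 \<le> x \<and> y < f x}"
    unfolding is_interval_1 using anti by (auto intro: less_le_trans)
  then have "{x. 0 \<le> x \<and> y < f x} \<in> sets borel"
    by (rule real_interval_borel_measurable)
  moreover have "{x. x < 0 \<and> y < f x} = (if y < undefined then {..<0} else {})"
    using undef by auto
  then have "{x. x < 0 \<and> y < f x} \<in> sets borel"
    by simp
  ultimately have "{x. 0 \<le> x \<and> y < f x} \<union> {x. x < 0 \<and> y < f x} \<in> sets borel"
    by (rule sets.Un)
  also have "{x. 0 \<le> x \<and> y < f x} \<union> {x. x < 0 \<and> y < f x} = {x \<in> space borel. y < f x}"
    by auto
  finally show "{x \<in> space borel. y < f x} \<in> sets borel" .
qed

end

theory Submission
  imports Defs
begin

text \<open>
  For exchangeable nonnegative \<open>X\<^sub>1, \<dots>, X\<^sub>K\<close>, let \<open>E\<^sub>k\<close> be the event that \<open>k\<close> is the \<^emph>\<open>last\<close> index at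
  which the running mean is at least 1. It depends on \<open>X\<^sub>1, \<dots>, X\<^sub>k\<close> only through partial sums
  of order at least \<open>k\<close>, so it is invariant under permutations of the first \<open>k\<close> variables. Hence
  the mean of \<open>X\<^sub>1\<close> over \<open>E\<^sub>k\<close> is that of the \<open>k\<close>-th running mean, which is at least the
  probability of \<open>E\<^sub>k\<close>. Summing over the disjoint events \<open>E\<^sub>k\<close> yields a maximal form of Markov's
  inequality, with \<open>\<E> X\<^sub>1\<close> as the bound. For \<open>X\<^sub>i = f (P\<^sub>i / \<alpha>)\<close> this expectation
  is at most \<open>\<alpha>\<close>, by the substitution \<open>p \<mapsto> \<alpha> p\<close>.
\<close>

text \<open>Both integrals are integrals of \<open>F\<close> against the joint law of a vector, and
  exchangeability says that the two laws coincide.\<close>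

lemma exchangeable_nn_integral_permute:
  assumes "exchangeable M I P" and \<sigma>: "\<sigma> permutes I"
    and F: "F \<in> borel_measurable (\<Pi>\<^sub>M i\<in>I. borel)"
  shows "(\<integral>\<^sup>+\<omega>. F (\<lambda>i\<in>I. P (\<sigma> i) \<omega>) \<partial>M) = (\<integral>\<^sup>+\<omega>. F (\<lambda>i\<in>I. P i \<omega>) \<partial>M)"
proof -
  have P: "P i \<in> borel_measurable M" if "i \<in> I" for i
    using assms that by (auto simp: exchangeable_def)
  let ?X = "\<lambda>\<omega>. \<lambda>i\<in>I. P (\<sigma> i) \<omega>" and ?Y = "\<lambda>\<omega>. \<lambda>i\<in>I. P i \<omega>"
  let ?N = "\<Pi>\<^sub>M i\<in>I. (borel :: real measure)"
  have X: "?X \<in> M \<rightarrow>\<^sub>M ?N"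
    using P permutes_in_image[OF \<sigma>] by (intro measurable_restrict) auto
  have Y: "?Y \<in> M \<rightarrow>\<^sub>M ?N"
    using P by (rule measurable_restrict)
  have "(\<integral>\<^sup>+\<omega>. F (?X \<omega>) \<partial>M) = (\<integral>\<^sup>+x. F x \<partial>distr M ?N ?X)"
    using X F by (simp add: nn_integral_distr)
  also have "distr M ?N ?X = distr M ?N ?Y"
    using assms by (auto simp: exchangeable_def)
  also have "(\<integral>\<^sup>+x. F x \<partial>distr M ?N ?Y) = (\<integral>\<^sup>+\<omega>. F (?Y \<omega>) \<partial>M)"
    using Y F by (simp add: nn_integral_distr)
  finally show ?thesis .
qed

text \<open>This isolates the contribution of exchangeability; the law of \<open>P 1\<close> enters
  only when the bound is evaluated. The mean condition is multiplied by \<open>k\<close>, which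
  keeps division in \<open>ennreal\<close> out of the argument.\<close>

lemma exchangeable_maximal_Markov:
  fixes P :: "nat \<Rightarrow> 'a \<Rightarrow> real" and h :: "real \<Rightarrow> ennreal"
  assumes exch: "exchangeable M {1..K} P"
    and h [measurable]: "h \<in> borel_measurable borel"
  shows "emeasure M {\<omega> \<in> space M. \<exists>k\<in>{1..K}. of_nat k \<le> (\<Sum>i=1..k. h (P i \<omega>))}
    \<le> (\<integral>\<^sup>+\<omega>. h (P 1 \<omega>) \<partial>M)"
proof (cases "K = 0")
  case True
  then show ?thesis by simp
next
  case False
  \<comment> \<open>\<open>Q k\<close> says that \<open>k\<close> is the last index in {1..K} with
    running mean at least 1. It is a predicate on vectors, not on outcomes, so that it can be
    integrated against the joint law.\<close>
  define Q where "Q k x \<longleftrightarrow> of_nat k \<le> (\<Sum>i=1..k. h (x i)) \<and>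
    (\<forall>j\<in>{k<..K}. \<not> of_nat j \<le> (\<Sum>i=1..j. h (x i)))" for k and x :: "nat \<Rightarrow> real"
  define E where "E k = {\<omega> \<in> space M. Q k (\<lambda>i. P i \<omega>)}" for k
  have P [measurable]: "P i \<in> borel_measurable M" if "i \<in> {1..K}" for i
    using exch that by (auto simp: exchangeable_def)
  have hP: "(\<lambda>\<omega>. h (P i \<omega>)) \<in> borel_measurable M" if "i \<in> {1..K}" for i
    using P[OF that] by measurable
  have Q_meas: "Measurable.pred (\<Pi>\<^sub>M i\<in>{1..K}. borel) (Q k)" if "k \<in> {1..K}" for k
  proof -
    have "(\<lambda>x. h (x i)) \<in> borel_measurable (\<Pi>\<^sub>M i\<in>{1..K}. borel)" if "i \<in> {1..K}" for i
      using that by measurable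
    then have [measurable]: "(\<lambda>x. \<Sum>i=1..j. h (x i)) \<in> borel_measurable (\<Pi>\<^sub>M i\<in>{1..K}. borel)"
      if "j \<le> K" for j
      using that by (intro borel_measurable_sum) auto
    show ?thesis
      unfolding Q_def by measurable (use that in auto)
  qed
  \<comment> \<open>The joint law lives on vectors restricted to {1..K}; \<open>Q k\<close> reads no
    other coordinates.\<close>
  have Q_restrict: "Q k (restrict x {1..K}) \<longleftrightarrow> Q k x" if "k \<in> {1..K}" for k x
  proof -
    have "(\<Sum>i=1..j. h (restrict x {1..K} i)) = (\<Sum>i=1..j. h (x i))" if "j \<le> K" for j
      using that by (intro sum.cong) auto
    then show ?thesis
      using that unfolding Q_def by auto
  qed
  have E_meas: "E k \<in> sets M" if "k \<in> {1..K}" for k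
  proof -
    have "(\<lambda>\<omega>. \<lambda>i\<in>{1..K}. P i \<omega>) \<in> M \<rightarrow>\<^sub>M (\<Pi>\<^sub>M i\<in>{1..K}. borel)"
      using P by (rule measurable_restrict)
    from measurable_compose[OF this Q_meas[OF that]]
    have "Measurable.pred M (\<lambda>\<omega>. Q k (\<lambda>i. P i \<omega>))"
      using Q_restrict[OF that] by (simp cong: measurable_cong)
    then show ?thesis
      by (simp add: E_def pred_def)
  qed
  have swap: "(\<integral>\<^sup>+\<omega>. h (P i \<omega>) * indicator (E k) \<omega> \<partial>M) = (\<integral>\<^sup>+\<omega>. h (P 1 \<omega>) * indicator (E k) \<omega> \<partial>M)"
    if k: "k \<in> {1..K}" and i: "i \<in> {1..k}" for k i
  proof -
    define \<sigma> where "\<sigma> = Transposition.transpose 1 i"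
    have \<sigma>: "\<sigma> permutes {1..j}" if "k \<le> j" for j
      unfolding \<sigma>_def using i that by (intro permutes_swap_id) auto
    \<comment> \<open>Both swapped indices are at most \<open>k\<close>, so every sum of order at
      least \<open>k\<close> is unchanged. This is why the last index is chosen: the first one would
      involve shorter sums, which the swap can alter.\<close>
    have "(\<Sum>l=1..j. h (x (\<sigma> l))) = (\<Sum>l=1..j. h (x l))" if "k \<le> j" for j and x :: "nat \<Rightarrow> real"
      using sum.permute[OF \<sigma>[OF that], of "\<lambda>l. h (x l)"] by simp
    then have Q_\<sigma>: "Q k (\<lambda>l. x (\<sigma> l)) \<longleftrightarrow> Q k x" for x :: "nat \<Rightarrow> real"
      unfolding Q_def by auto
    \<comment> \<open>At the permuted vector, coordinate 1 is \<open>P i\<close>, while the event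
      \<open>Q k\<close> stays the same.\<close>
    define F where "F x = (if Q k x then h (x 1) else 0)" for x :: "nat \<Rightarrow> real"
    have [measurable]: "Measurable.pred (\<Pi>\<^sub>M i\<in>{1..K}. borel) (Q k)"
      using Q_meas[OF k] .
    have [measurable]: "(\<lambda>x. h (x 1)) \<in> borel_measurable (\<Pi>\<^sub>M i\<in>{1..K}. borel)"
      by measurable (use \<open>K \<noteq> 0\<close> in auto)
    have F: "F \<in> borel_measurable (\<Pi>\<^sub>M i\<in>{1..K}. borel)"
      unfolding F_def by measurable
    have "(\<integral>\<^sup>+\<omega>. h (P i \<omega>) * indicator (E k) \<omega> \<partial>M) = (\<integral>\<^sup>+\<omega>. F (\<lambda>l\<in>{1..K}. P (\<sigma> l) \<omega>) \<partial>M)"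
    proof (rule nn_integral_cong)
      fix \<omega> assume "\<omega> \<in> space M"
      moreover have "Q k (\<lambda>l\<in>{1..K}. P (\<sigma> l) \<omega>) \<longleftrightarrow> Q k (\<lambda>l. P l \<omega>)"
        using Q_restrict[OF k, of "\<lambda>l. P (\<sigma> l) \<omega>"] Q_\<sigma>[of "\<lambda>l. P l \<omega>"] by simp
      moreover have "\<sigma> 1 = i"
        by (simp add: \<sigma>_def)
      ultimately show "h (P i \<omega>) * indicator (E k) \<omega> = F (\<lambda>l\<in>{1..K}. P (\<sigma> l) \<omega>)"
        using k by (simp add: F_def E_def indicator_def)
    qed
    also have "\<dots> = (\<integral>\<^sup>+\<omega>. F (\<lambda>l\<in>{1..K}. P l \<omega>) \<partial>M)"
      using exch \<sigma>[of K] k F by (intro exchangeable_nn_integral_permute) auto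
    also have "\<dots> = (\<integral>\<^sup>+\<omega>. h (P 1 \<omega>) * indicator (E k) \<omega> \<partial>M)"
      using k Q_restrict[OF k]
      by (intro nn_integral_cong) (auto simp: F_def E_def indicator_def)
    finally show ?thesis .
  qed
  have bound: "emeasure M (E k) \<le> (\<integral>\<^sup>+\<omega>. h (P 1 \<omega>) * indicator (E k) \<omega> \<partial>M)" if k: "k \<in> {1..K}" for k
  proof -
    \<comment> \<open>Markov's inequality on \<open>E k\<close>, where the sum is at least
      \<open>k\<close>. By \<open>swap\<close> its \<open>k\<close> terms have equal integrals, so
      the factor \<open>k\<close>, positive and finite, cancels.\<close>
    have "of_nat k * emeasure M (E k) = (\<integral>\<^sup>+\<omega>. of_nat k * indicator (E k) \<omega> \<partial>M)"
      using E_meas[OF k] by (simp add: nn_integral_cmult_indicator)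
    also have "\<dots> \<le> (\<integral>\<^sup>+\<omega>. (\<Sum>i=1..k. h (P i \<omega>) * indicator (E k) \<omega>) \<partial>M)"
      by (intro nn_integral_mono) (auto simp: E_def Q_def indicator_def)
    also have "\<dots> = (\<Sum>i=1..k. \<integral>\<^sup>+\<omega>. h (P i \<omega>) * indicator (E k) \<omega> \<partial>M)"
      using k hP E_meas[OF k]
      by (intro nn_integral_sum borel_measurable_times_ennreal borel_measurable_indicator) auto
    also have "\<dots> = (\<Sum>i=1..k. \<integral>\<^sup>+\<omega>. h (P 1 \<omega>) * indicator (E k) \<omega> \<partial>M)"
      using swap[OF k] by (rule sum.cong[OF refl])
    also have "\<dots> = of_nat k * (\<integral>\<^sup>+\<omega>. h (P 1 \<omega>) * indicator (E k) \<omega> \<partial>M)"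
      by simp
    finally show ?thesis
      using k by (subst (asm) ennreal_mult_le_mult_iff) auto
  qed
  have disj: "disjoint_family_on E {1..K}"
  proof -
    \<comment> \<open>On \<open>E l\<close> the mean at \<open>l\<close> is at least 1, which
      \<open>E k\<close> excludes for later indices.\<close>
    have "E k \<inter> E l = {}" if "k < l" "l \<le> K" for k l
      using that by (auto simp: E_def Q_def)
    then show ?thesis
      unfolding disjoint_family_on_def by (metis Int_commute atLeastAtMost_iff linorder_neqE_nat)
  qed
  have "{\<omega> \<in> space M. \<exists>k\<in>{1..K}. of_nat k \<le> (\<Sum>i=1..k. h (P i \<omega>))} \<subseteq> (\<Union>k\<in>{1..K}. E k)"
  proof safe
    fix \<omega> k assume \<omega>: "\<omega> \<in> space M" "k \<in> {1..K}" "of_nat k \<le> (\<Sum>i=1..k. h (P i \<omega>))"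
    define S where "S = {j \<in> {1..K}. of_nat j \<le> (\<Sum>i=1..j. h (P i \<omega>))}"
    have S: "finite S" "S \<noteq> {}"
      using \<omega> by (auto simp: S_def)
    define m where "m = Max S"
    have m: "m \<in> S"
      unfolding m_def using S by (rule Max_in)
    have "j \<notin> S" if "m < j" for j
      using that S Max_ge[of S j] by (auto simp: m_def)
    with m \<omega>(1) have "m \<in> {1..K}" "\<omega> \<in> E m"
      unfolding E_def Q_def S_def by fastforce+
    then show "\<omega> \<in> (\<Union>k\<in>{1..K}. E k)"
      by blast
  qed
  then have "emeasure M {\<omega> \<in> space M. \<exists>k\<in>{1..K}. of_nat k \<le> (\<Sum>i=1..k. h (P i \<omega>))}
      \<le> emeasure M (\<Union>k\<in>{1..K}. E k)"
    using E_meas by (intro emeasure_mono) auto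
  also have "\<dots> \<le> (\<Sum>k\<in>{1..K}. emeasure M (E k))"
    using E_meas by (intro emeasure_subadditive_finite) auto
  also have "\<dots> \<le> (\<Sum>k\<in>{1..K}. \<integral>\<^sup>+\<omega>. h (P 1 \<omega>) * indicator (E k) \<omega> \<partial>M)"
    using bound by (rule sum_mono)
  also have "\<dots> = (\<integral>\<^sup>+\<omega>. (\<Sum>k\<in>{1..K}. h (P 1 \<omega>) * indicator (E k) \<omega>) \<partial>M)"
    using hP E_meas \<open>K \<noteq> 0\<close>
    by (intro nn_integral_sum[symmetric] borel_measurable_times_ennreal borel_measurable_indicator) auto
  \<comment> \<open>Disjointness makes the indicators add up to that of the union, so the mean of
    \<open>h (P 1 \<omega>)\<close> is counted at most once.\<close>
  also have "\<dots> = (\<integral>\<^sup>+\<omega>. h (P 1 \<omega>) * indicator (\<Union>k\<in>{1..K}. E k) \<omega> \<partial>M)"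
    using disj by (simp add: indicator_UN_disjoint sum_distrib_left)
  also have "\<dots> \<le> (\<integral>\<^sup>+\<omega>. h (P 1 \<omega>) \<partial>M)"
    by (intro nn_integral_mono) (auto simp: indicator_def)
  finally show ?thesis .
qed

text \<open>Substituting p = \<alpha> q produces the factor \<alpha> and the domain [0, 1/\<alpha>].
  Since \<open>f\<close> vanishes beyond 1, this domain shrinks to [0, 1], where the integral is at
  most 1.\<close>

lemma calibrator_nn_integral_uniform:
  assumes f: "calibrator f" and \<alpha>: "0 < \<alpha>" "\<alpha> \<le> 1"
  shows "(\<integral>\<^sup>+p. f (p / \<alpha>) \<partial>uniform_measure lborel {0..1}) \<le> ennreal \<alpha>"
proof -
  have [measurable]: "f \<in> borel_measurable borel"
    using f by (rule calibrator_borel_measurable)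
  have "(\<integral>\<^sup>+p. f (p / \<alpha>) \<partial>uniform_measure lborel {0..1}) =
      (\<integral>\<^sup>+p. f (p / \<alpha>) * indicator {0..1} p \<partial>lborel)"
    by (subst nn_integral_uniform_measure) (auto simp: divide_ennreal_def)
  also have "\<dots> = ennreal \<alpha> * (\<integral>\<^sup>+p. f p * indicator {0..1} (\<alpha> * p) \<partial>lborel)"
    using \<alpha> by (subst nn_integral_real_affine[where c = \<alpha> and t = 0]) auto
  also have "(\<integral>\<^sup>+p. f p * indicator {0..1} (\<alpha> * p) \<partial>lborel) = (\<integral>\<^sup>+p\<in>{0..1}. f p \<partial>lborel)"
  proof (rule nn_integral_cong)
    fix p :: real
    have "f p = 0" if "1 < p"
      using f that by (auto simp: calibrator_def)
    moreover have "\<alpha> * p \<le> 1" if "0 \<le> p" "p \<le> 1"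
      using \<alpha> that by (intro mult_le_one) auto
    ultimately show "f p * indicator {0..1} (\<alpha> * p) = f p * indicator {0..1} p"
      using \<alpha> by (auto simp: indicator_def zero_le_mult_iff not_le)
  qed
  also have "ennreal \<alpha> * \<dots> \<le> ennreal \<alpha> * 1"
    using f by (intro mult_left_mono) (auto simp: calibrator_def)
  finally show ?thesis
    by simp
qed

theorem theorem3p2:
  fixes M :: "'a measure" and K :: nat and f :: "real \<Rightarrow> ennreal"
    and P :: "nat \<Rightarrow> 'a \<Rightarrow> real" and \<alpha> :: real
  assumes "prob_space M"
    and "2 \<le> K"
    and "calibrator f"
    and "exchangeable M {1..K} P"
    and "\<And>i. i \<in> {1..K} \<Longrightarrow> distr M borel (P i) = uniform_measure lborel {0..1}"
    and "0 < \<alpha>" and "\<alpha> < 1"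
  shows "measure M {\<omega> \<in> space M. \<exists>k\<in>{1..K}.
           1 / of_nat k * (\<Sum>i=1..k. f (P i \<omega> / \<alpha>)) \<ge> 1} \<le> \<alpha>"
proof -
  interpret prob_space M by fact
  have [measurable]: "f \<in> borel_measurable borel"
    using assms(3) by (rule calibrator_borel_measurable)
  have P: "P 1 \<in> borel_measurable M"
    using assms by (auto simp: exchangeable_def)
  \<comment> \<open>Multiplying by \<open>k\<close> is reversible in \<open>ennreal\<close> because
    \<open>k\<close> is neither 0 nor infinite; \<open>S\<close> itself may be infinite.\<close>
  have mean_ge: "1 / of_nat k * S \<ge> 1 \<longleftrightarrow> of_nat k \<le> S" if "k \<in> {1..K}" for k and S :: ennreal
  proof -
    have k: "0 < (of_nat k :: ennreal)" "(of_nat k :: ennreal) < top"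
      using that by (auto simp: of_nat_less_top)
    have "of_nat k * (1 / of_nat k * S) = (of_nat k / of_nat k) * S"
      by (simp add: ennreal_times_divide mult.assoc[symmetric])
    also have "\<dots> = S"
      using k by simp
    finally have "of_nat k * (1 / of_nat k * S) = S" .
    then show ?thesis
      using ennreal_mult_le_mult_iff[of "of_nat k" 1 "1 / of_nat k * S"] k by auto
  qed
  let ?A = "{\<omega> \<in> space M. \<exists>k\<in>{1..K}. of_nat k \<le> (\<Sum>i=1..k. f (P i \<omega> / \<alpha>))}"
  \<comment> \<open>The maximal inequality is applied with \<open>h\<close> taken as the rescaled
    calibrator \<open>\<lambda>p. f (p / \<alpha>)\<close>.\<close>
  have "emeasure M ?A \<le> (\<integral>\<^sup>+\<omega>. f (P 1 \<omega> / \<alpha>) \<partial>M)"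
    using assms(4) by (rule exchangeable_maximal_Markov) measurable
  also have "\<dots> = (\<integral>\<^sup>+p. f (p / \<alpha>) \<partial>distr M borel (P 1))"
    using P by (simp add: nn_integral_distr)
  also have "\<dots> = (\<integral>\<^sup>+p. f (p / \<alpha>) \<partial>uniform_measure lborel {0..1})"
    using assms by simp
  also have "\<dots> \<le> ennreal \<alpha>"
    using assms by (intro calibrator_nn_integral_uniform) auto
  finally have "measure M ?A \<le> \<alpha>"
    using assms by (simp add: emeasure_eq_measure)
  also have "?A = {\<omega> \<in> space M. \<exists>k\<in>{1..K}. 1 / of_nat k * (\<Sum>i=1..k. f (P i \<omega> / \<alpha>)) \<ge> 1}"
    using mean_ge by blast
  finally show ?thesis .
qed

end
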